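(* Let $Y$ be a locally compact space with a Radon measure $\mu$, and let $\langle\mathfrak V,\mathfrak Q;X,Y\rangle$ be an invariant $(\Theta,\mathcal E,\mu)$-structure with $\mathfrak V=\langle\langle\mathfrak E,\tau\rangle,\pi,X,\{\nu_j:j\in J\}\rangle$, $\mathfrak Q=\langle\langle\mathfrak H,\gamma\rangle,\xi,X,\mathfrak Y\rangle$, where $\Theta=\{B_w:w\in\mathcal E\}$ with $B_w(x)=\{w(x)\}$. Then for all $x\in X$ $$\Bigl\{H\in\Bigl[\Bigl(\prod^b_{z\in X}\mathfrak H_z\Bigr)^x_\diamond\Bigr]_{peq}:\ H_t\bullet\mathcal E(\Theta)\subseteq\Gamma^x(\pi)\ \ \forall t\in Y\Bigr\}\subseteq\Gamma_\diamond^x(\xi).$$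
   Context: Vector spaces are over $\mathbb C$; Hlcs means Hausdorff locally convex space. Bundles. A bundle of $\Omega$-spaces $\langle\langle\mathfrak E,\tau\rangle,\pi,X,\mathfrak N\rangle$ (Gierz) consists of topological spaces $\langle\mathfrak E,\tau\rangle$ and $X$, a continuous open surjection $\pi:\mathfrak E\to X$, a vector space structure on each stalk $\mathfrak E_x=\pi^{-1}(x)$ such that addition $\{(a,b):\pi(a)=\pi(b)\}\to\mathfrak E$ and scalar multiplication are continuous, and a set $\mathfrak N=\{\nu_j:j\in J\}$ of functions $\mathfrak E\to[0,\infty[$ whose restrictions to each $\mathfrak E_x$ form a directed family of seminorms generating the (Hausdorff) topology induced by $\tau$ on $\mathfrak E_x$. For $U\subseteq X$, $\prod^b_{x\in U}\mathfrak E_x$ is the set of $\sigma\in\prod_{x\in U}\mathfrak E_x$ with $\sup_{x\in U}\nu_j(\sigma(x))<\infty$ for all $j$; $\Gamma_U(\pi)$ (resp. $\Gamma_U^x(\pi)$) is the set of those continuous (resp. continuous at $x\in U$); $U$ is omitted if $U=X$. The tubes $\{\beta:\pi(\beta)\in U,\nu_j(\beta-\sigma(\pi(\beta)))<\varepsilon\}$ ($U$ open, $\sigma\in\Gamma_U(\pi)$, $\varepsilon>0$, $j\in J$) form a base of $\tau$. For a set $A$ of sections of $\mathfrak Q$, $A_\diamond^x=\{H\in A:\exists F\in\Gamma(\xi),\ H(x)=F(x)\}$, and $\Gamma_\diamond^x(\xi)=(\Gamma^x(\xi))^x_\diamond$. $\mathfrak L_1(Y,E,\mu)$ ($E$ a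 Hlcs): scalarly essentially $\mu$-integrable maps $Y\to E$ whose (weak) integral belongs to $E$ (Bourbaki). $(\Theta,\mathcal E,\mu)$-structure. Let $\mathcal E\subseteq\Gamma(\pi)$, $\Theta\subseteq\prod_xBounded(\mathfrak E_x)$, $\mathsf D(B,\mathcal E)=\mathcal E\cap\prod_xB(x)$, $\mathcal B_B^x=\{v(x):v\in\mathsf D(B,\mathcal E)\}$, $S_x=\{\mathcal B_B^x:B\in\Theta\}$, $\mathcal E(\Theta)=\bigcup_B\mathsf D(B,\mathcal E)$; $\mathcal L_{S_x}(\mathfrak E_x)$: continuous linear endomorphisms with uniform convergence on members of $S_x$. $\langle\mathfrak V,\mathfrak Q;X,Y\rangle$ is a $(\Theta,\mathcal E,\mu)$-structure if all $\mathsf D(B,\mathcal E)\ne\emptyset$, $\bigcup_B\mathcal B_B^x$ is total in $\mathfrak E_x$ for all $x$, and $\mathfrak Q$ is a bundle of $\Omega$-spaces with $\mathfrak H_x\subseteq\mathfrak L_1(Y,\mathcal L_{S_x}(\mathfrak E_x),\mu)$ and directed family of seminorms $\sup_{(t,j,B)\in O}P^x_{(t,j,B)}$, $O$ finite $\subset Y\times J\times\Theta$, $P^x_{(t,j,B)}(F)=\sup_{v\in\mathsf D(B,\mathcal E)}\nu_j(F(t)v(x))$. For $F\in\prod_x\mathcal L(\mathfrak E_x)^Y$, $t\in Y$: $F_t(x)=F(x)(t)$; $(Q\bullet w)(x)=Q(x)(w(x))$. The structure is invariant if $\{F\in\prod_z^b\mathfrak H_z:F_t\bullet\mathcal E(\Theta)\subseteq\Gamma(\pi)\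 \forall t\in Y\}=\Gamma(\xi)$. (For $\Theta=\{B_w:w\in\mathcal E\}$ one has $\mathsf D(B_w,\mathcal E)=\{w\}$ and $\mathcal E(\Theta)=\mathcal E$.) For a set $A\subseteq\prod_x\mathfrak H_x$, $A_{peq}$ is the set of pointwise equicontinuous $F\in A$: for every $t\in Y$ and $j\in J$ there are $a>0$, $j_1\in J$ with $\nu_j(F(z)(t)v_z)\le a\,\nu_{j_1}(v_z)$ for all $z\in X$, $v_z\in\mathfrak E_z$. *)

theory Defs
  imports
    "HOL-Analysis.Analysis"
    "HOL-Algebra.Module"
    "HOL-Algebra.Algebraic_Closure_Type"
begin

abbreviation complex_field :: "complex ring"
  where "complex_field \<equiv> ring_of_type_algebra"

definition linear_maps ::
    "(complex, 'a) module \<Rightarrow> (complex, 'b) module \<Rightarrow> ('a \<Rightarrow> 'b) set"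
  where "linear_maps M N =
    {T \<in> carrier M \<rightarrow>\<^sub>E carrier N.
       (\<forall>a\<in>carrier M. \<forall>b\<in>carrier M. T (a \<oplus>\<^bsub>M\<^esub> b) = T a \<oplus>\<^bsub>N\<^esub> T b) \<and>
       (\<forall>c. \<forall>a\<in>carrier M. T (c \<odot>\<^bsub>M\<^esub> a) = c \<odot>\<^bsub>N\<^esub> T a)}"

definition seminorm_on :: "(complex, 'a) module \<Rightarrow> ('a \<Rightarrow> real) \<Rightarrow> bool"
  where "seminorm_on M p \<longleftrightarrow>
    (\<forall>a\<in>carrier M. 0 \<le> p a) \<and>
    (\<forall>a\<in>carrier M. \<forall>b\<in>carrier M. p (a \<oplus>\<^bsub>M\<^esub> b) \<le> p a + p b) \<and>
    (\<forall>c. \<forall>a\<in>carrier M. p (c \<odot>\<^bsub>M\<^esub> a) = cmod c * p a)"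

definition seminorm_topology :: "(complex, 'a) module \<Rightarrow> ('a \<Rightarrow> real) set \<Rightarrow> 'a topology"
  where "seminorm_topology M P = topology_generated_by
    (insert (carrier M)
      {{b \<in> carrier M. p (b \<ominus>\<^bsub>M\<^esub> a) < \<epsilon>} | p a \<epsilon>. p \<in> P \<and> a \<in> carrier M \<and> \<epsilon> > 0})"

definition linear_span :: "(complex, 'a) module \<Rightarrow> 'a set \<Rightarrow> 'a set"
  where "linear_span M A = (\<lambda>W. submodule W complex_field M) hull A"

definition scalar_module :: "(complex, complex) module"
  where "scalar_module =
    \<lparr>carrier = UNIV, mult = (*), one = 1, zero = 0, add = (+), smult = (*)\<rparr>"

definition continuous_dual ::
    "(complex, 'a) module \<Rightarrow> ('a \<Rightarrow> real) set \<Rightarrow> ('a \<Rightarrow> complex) set"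
  where "continuous_dual M P =
    {l \<in> linear_maps M scalar_module. continuous_map (seminorm_topology M P) euclidean l}"

text \<open>
  Following Bourbaki, a Radon measure on a locally compact space is a (complex) linear form on the
  space of continuous functions with compact support, continuous for the inductive limit topology.
  Functions with compact support are taken to vanish outside the carrier of the space.
\<close>

definition Cc :: "'y topology \<Rightarrow> ('y \<Rightarrow> complex) set"
  where "Cc Y = {f. continuous_map Y euclidean f \<and>
    (\<exists>K. compactin Y K \<and> (\<forall>y. y \<notin> K \<longrightarrow> f y = 0))}"

definition radon_measure :: "'y topology \<Rightarrow> (('y \<Rightarrow> complex) \<Rightarrow> complex) \<Rightarrow> bool"
  where "radon_measure Y \<mu> \<longleftrightarrow>
    (\<forall>f\<in>Cc Y. \<forall>g\<in>Cc Y. \<mu> (\<lambda>y. f y + g y) = \<mu> f + \<mu> g) \<and>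
    (\<forall>c. \<forall>f\<in>Cc Y. \<mu> (\<lambda>y. c * f y) = c * \<mu> f) \<and>
    (\<forall>K. compactin Y K \<longrightarrow>
      (\<exists>M. \<forall>f\<in>Cc Y. \<forall>b. (\<forall>y. y \<notin> K \<longrightarrow> f y = 0) \<and> (\<forall>y. cmod (f y) \<le> b)
              \<longrightarrow> cmod (\<mu> f) \<le> M * b))"

text \<open>
  The absolute value \<open>|\<mu>|\<close> on nonnegative functions with compact support, its upper integral
  (first on lower semicontinuous functions, then on arbitrary ones), and the essential upper
  integral, which is the supremum of the upper integrals over compact sets.
\<close>

definition radon_abs :: "'y topology \<Rightarrow> (('y \<Rightarrow> complex) \<Rightarrow> complex) \<Rightarrow> ('y \<Rightarrow> real) \<Rightarrow> ennreal"
  where "radon_abs Y \<mu> \<phi> = (SUP g\<in>{g \<in> Cc Y. \<forall>y. cmod (g y) \<le> \<phi> y}. ennreal (cmod (\<mu> g)))"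

definition upper_integral_lsc ::
    "'y topology \<Rightarrow> (('y \<Rightarrow> complex) \<Rightarrow> complex) \<Rightarrow> ('y \<Rightarrow> ennreal) \<Rightarrow> ennreal"
  where "upper_integral_lsc Y \<mu> h =
    (SUP \<phi>\<in>{\<phi>. (\<lambda>y. complex_of_real (\<phi> y)) \<in> Cc Y \<and> (\<forall>y. 0 \<le> \<phi> y) \<and>
               (\<forall>y\<in>topspace Y. ennreal (\<phi> y) \<le> h y)}. radon_abs Y \<mu> \<phi>)"

definition upper_integral ::
    "'y topology \<Rightarrow> (('y \<Rightarrow> complex) \<Rightarrow> complex) \<Rightarrow> ('y \<Rightarrow> ennreal) \<Rightarrow> ennreal"
  where "upper_integral Y \<mu> f =
    (INF h\<in>{h. (\<forall>a. openin Y {y \<in> topspace Y. a < h y}) \<and> (\<forall>y\<in>topspace Y. f y \<le> h y)}.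
       upper_integral_lsc Y \<mu> h)"

definition ess_upper_integral ::
    "'y topology \<Rightarrow> (('y \<Rightarrow> complex) \<Rightarrow> complex) \<Rightarrow> ('y \<Rightarrow> ennreal) \<Rightarrow> ennreal"
  where "ess_upper_integral Y \<mu> f =
    (SUP K\<in>{K. compactin Y K}. upper_integral Y \<mu> (\<lambda>y. f y * indicator K y))"

text \<open>
  The essentially integrable functions are the closure of \<^term>\<open>Cc Y\<close> for the seminorm given by
  the essential upper integral of the modulus; the integral is the continuous extension of \<open>\<mu>\<close>.
\<close>

definition has_ess_integral ::
    "'y topology \<Rightarrow> (('y \<Rightarrow> complex) \<Rightarrow> complex) \<Rightarrow> ('y \<Rightarrow> complex) \<Rightarrow> complex \<Rightarrow> bool"
  where "has_ess_integral Y \<mu> f I \<longleftrightarrow>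
    (\<forall>\<epsilon>>0. \<exists>\<phi>\<in>Cc Y. ess_upper_integral Y \<mu> (\<lambda>y. ennreal (cmod (f y - \<phi> y))) \<le> ennreal \<epsilon> \<and>
                     cmod (I - \<mu> \<phi>) \<le> \<epsilon>)"

text \<open>
  \<open>L1_space Y \<mu> M P\<close> is the set of scalarly essentially \<open>\<mu>\<close>-integrable maps from \<open>Y\<close> to the
  locally convex space \<open>M\<close> (topologized by the seminorms \<open>P\<close>) whose weak integral lies in \<open>M\<close>.
\<close>

definition L1_space ::
    "'y topology \<Rightarrow> (('y \<Rightarrow> complex) \<Rightarrow> complex) \<Rightarrow> (complex, 'a) module \<Rightarrow> ('a \<Rightarrow> real) set
      \<Rightarrow> ('y \<Rightarrow> 'a) set"
  where "L1_space Y \<mu> M P =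
    {f \<in> topspace Y \<rightarrow>\<^sub>E carrier M.
       (\<forall>l\<in>continuous_dual M P. \<exists>I. has_ess_integral Y \<mu> (\<lambda>t. l (f t)) I) \<and>
       (\<exists>e\<in>carrier M. \<forall>l\<in>continuous_dual M P. has_ess_integral Y \<mu> (\<lambda>t. l (f t)) (l e))}"

record ('x, 'e, 'j) tvs_bundle =
  total :: "'e topology"
  proj :: "'e \<Rightarrow> 'x"
  base_space :: "'x topology"
  stalk :: "'x \<Rightarrow> (complex, 'e) module"
  sn_index :: "'j set"
  sn :: "'j \<Rightarrow> 'e \<Rightarrow> real"

definition bounded_sections :: "('x, 'e, 'j) tvs_bundle \<Rightarrow> 'x set \<Rightarrow> ('x \<Rightarrow> 'e) set"
  where "bounded_sections V U =
    {\<sigma> \<in> (\<Pi>\<^sub>E x\<in>U. carrier (stalk V x)). \<forall>j\<in>sn_index V. bdd_above ((\<lambda>x. sn V j (\<sigma> x)) ` U)}"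

definition cont_sections_on :: "('x, 'e, 'j) tvs_bundle \<Rightarrow> 'x set \<Rightarrow> ('x \<Rightarrow> 'e) set"
  where "cont_sections_on V U =
    {\<sigma> \<in> bounded_sections V U. continuous_map (subtopology (base_space V) U) (total V) \<sigma>}"

definition cont_sections_on_at :: "('x, 'e, 'j) tvs_bundle \<Rightarrow> 'x set \<Rightarrow> 'x \<Rightarrow> ('x \<Rightarrow> 'e) set"
  where "cont_sections_on_at V U x =
    {\<sigma> \<in> bounded_sections V U. topcontinuous_at (subtopology (base_space V) U) (total V) \<sigma> x}"

abbreviation cont_sections :: "('x, 'e, 'j) tvs_bundle \<Rightarrow> ('x \<Rightarrow> 'e) set"
  where "cont_sections V \<equiv> cont_sections_on V (topspace (base_space V))"

abbreviation cont_sections_at :: "('x, 'e, 'j) tvs_bundle \<Rightarrow> 'x \<Rightarrow> ('x \<Rightarrow> 'e) set"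
  where "cont_sections_at V x \<equiv> cont_sections_on_at V (topspace (base_space V)) x"

definition tube :: "('x, 'e, 'j) tvs_bundle \<Rightarrow> 'x set \<Rightarrow> ('x \<Rightarrow> 'e) \<Rightarrow> real \<Rightarrow> 'j \<Rightarrow> 'e set"
  where "tube V U \<sigma> \<epsilon> j =
    {\<beta> \<in> topspace (total V). proj V \<beta> \<in> U \<and>
        sn V j (\<beta> \<ominus>\<^bsub>stalk V (proj V \<beta>)\<^esub> \<sigma> (proj V \<beta>)) < \<epsilon>}"

definition tubes :: "('x, 'e, 'j) tvs_bundle \<Rightarrow> 'e set set"
  where "tubes V = {tube V U \<sigma> \<epsilon> j | U \<sigma> \<epsilon> j.
    openin (base_space V) U \<and> \<sigma> \<in> cont_sections_on V U \<and> \<epsilon> > 0 \<and> j \<in> sn_index V}"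

definition stalk_topology :: "('x, 'e, 'j) tvs_bundle \<Rightarrow> 'x \<Rightarrow> 'e topology"
  where "stalk_topology V x = subtopology (total V) (carrier (stalk V x))"

definition omega_bundle :: "('x, 'e, 'j) tvs_bundle \<Rightarrow> bool"
  where "omega_bundle V \<longleftrightarrow>
    continuous_map (total V) (base_space V) (proj V) \<and>
    open_map (total V) (base_space V) (proj V) \<and>
    proj V ` topspace (total V) = topspace (base_space V) \<and>
    (\<forall>x\<in>topspace (base_space V).
       module complex_field (stalk V x) \<and>
       carrier (stalk V x) = {e \<in> topspace (total V). proj V e = x}) \<and>
    continuous_map
      (subtopology (prod_topology (total V) (total V)) {(a, b). proj V a = proj V b})
      (total V) (\<lambda>(a, b). a \<oplus>\<^bsub>stalk V (proj V a)\<^esub> b) \<and>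
    continuous_map (prod_topology euclidean (total V)) (total V)
      (\<lambda>(c, a). c \<odot>\<^bsub>stalk V (proj V a)\<^esub> a) \<and>
    (\<forall>x\<in>topspace (base_space V).
       (\<forall>j\<in>sn_index V. seminorm_on (stalk V x) (sn V j)) \<and>
       (\<forall>i\<in>sn_index V. \<forall>j\<in>sn_index V. \<exists>k\<in>sn_index V. \<forall>e\<in>carrier (stalk V x).
          sn V i e \<le> sn V k e \<and> sn V j e \<le> sn V k e) \<and>
       stalk_topology V x = seminorm_topology (stalk V x) (sn V ` sn_index V) \<and>
       Hausdorff_space (stalk_topology V x)) \<and>
    openin (total V) = arbitrary union_of (\<lambda>T. T \<in> tubes V)"

definition endo_module :: "('x, 'e, 'j) tvs_bundle \<Rightarrow> 'x \<Rightarrow> (complex, 'e \<Rightarrow> 'e) module"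
  where "endo_module V x =
    (let M = stalk V x in
      \<lparr>carrier = {T \<in> linear_maps M M. continuous_map (stalk_topology V x) (stalk_topology V x) T},
       mult = compose (carrier M),
       one = restrict id (carrier M),
       zero = (\<lambda>e\<in>carrier M. \<zero>\<^bsub>M\<^esub>),
       add = (\<lambda>S T. \<lambda>e\<in>carrier M. S e \<oplus>\<^bsub>M\<^esub> T e),
       smult = (\<lambda>c T. \<lambda>e\<in>carrier M. c \<odot>\<^bsub>M\<^esub> T e)\<rparr>)"

definition bounded_sets :: "('x, 'e, 'j) tvs_bundle \<Rightarrow> 'x \<Rightarrow> 'e set set"
  where "bounded_sets V x =
    {A. A \<subseteq> carrier (stalk V x) \<and> (\<forall>j\<in>sn_index V. bdd_above (sn V j ` A))}"

definition D_set :: "('x, 'e, 'j) tvs_bundle \<Rightarrow> ('x \<Rightarrow> 'e set) \<Rightarrow> ('x \<Rightarrow> 'e) set \<Rightarrow> ('x \<Rightarrow> 'e) set"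
  where "D_set V B \<E> = \<E> \<inter> (\<Pi>\<^sub>E x\<in>topspace (base_space V). B x)"

definition B_set :: "('x, 'e, 'j) tvs_bundle \<Rightarrow> ('x \<Rightarrow> 'e) set \<Rightarrow> ('x \<Rightarrow> 'e set) \<Rightarrow> 'x \<Rightarrow> 'e set"
  where "B_set V \<E> B x = (\<lambda>v. v x) ` D_set V B \<E>"

definition S_family ::
    "('x, 'e, 'j) tvs_bundle \<Rightarrow> ('x \<Rightarrow> 'e set) set \<Rightarrow> ('x \<Rightarrow> 'e) set \<Rightarrow> 'x \<Rightarrow> 'e set set"
  where "S_family V \<Theta> \<E> x = (\<lambda>B. B_set V \<E> B x) ` \<Theta>"

definition E_Theta :: "('x, 'e, 'j) tvs_bundle \<Rightarrow> ('x \<Rightarrow> 'e set) set \<Rightarrow> ('x \<Rightarrow> 'e) set \<Rightarrow> ('x \<Rightarrow> 'e) set"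
  where "E_Theta V \<Theta> \<E> = (\<Union>B\<in>\<Theta>. D_set V B \<E>)"

definition unif_conv_seminorms ::
    "('x, 'e, 'j) tvs_bundle \<Rightarrow> 'e set set \<Rightarrow> (('e \<Rightarrow> 'e) \<Rightarrow> real) set"
  where "unif_conv_seminorms V S =
    {(\<lambda>T. SUP e\<in>A. sn V j (T e)) | j A. j \<in> sn_index V \<and> A \<in> S}"

definition P_seminorm ::
    "('x, 'e, 'j) tvs_bundle \<Rightarrow> ('x \<Rightarrow> 'e) set \<Rightarrow> 'x \<Rightarrow> 'y \<times> 'j \<times> ('x \<Rightarrow> 'e set)
      \<Rightarrow> ('y \<Rightarrow> 'e \<Rightarrow> 'e) \<Rightarrow> real"
  where "P_seminorm V \<E> x = (\<lambda>(t, j, B) F. SUP v\<in>D_set V B \<E>. sn V j (F t (v x)))"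

text \<open>
  The stalks of the second bundle are spaces of maps \<open>F\<close> from \<open>Y\<close> to the endomorphisms of the
  stalk over \<open>x\<close>. Their disjoint union is represented by pairs \<open>(x, F)\<close>, with pointwise vector
  space operations. The supremum over the empty set of seminorms is 0.
\<close>

type_synonym ('x, 'e, 'j, 'y) op_bundle =
  "('x, 'x \<times> ('y \<Rightarrow> 'e \<Rightarrow> 'e), ('y \<times> 'j \<times> ('x \<Rightarrow> 'e set)) set) tvs_bundle"

definition theta_structure ::
    "('x, 'e, 'j) tvs_bundle \<Rightarrow> ('x, 'e, 'j, 'y) op_bundle \<Rightarrow> 'y topology
      \<Rightarrow> ('x \<Rightarrow> 'e set) set \<Rightarrow> ('x \<Rightarrow> 'e) set \<Rightarrow> (('y \<Rightarrow> complex) \<Rightarrow> complex) \<Rightarrow> bool"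
  where "theta_structure V Q Y \<Theta> \<E> \<mu> \<longleftrightarrow>
    omega_bundle V \<and>
    \<E> \<subseteq> cont_sections V \<and>
    \<Theta> \<subseteq> (\<Pi>\<^sub>E x\<in>topspace (base_space V). bounded_sets V x) \<and>
    (\<forall>B\<in>\<Theta>. D_set V B \<E> \<noteq> {}) \<and>
    (\<forall>x\<in>topspace (base_space V).
       stalk_topology V x closure_of linear_span (stalk V x) (\<Union>B\<in>\<Theta>. B_set V \<E> B x)
         = carrier (stalk V x)) \<and>
    omega_bundle Q \<and>
    base_space Q = base_space V \<and>
    (\<forall>h\<in>topspace (total Q). proj Q h = fst h) \<and>
    (\<forall>x\<in>topspace (base_space V).
       carrier (stalk Q x) \<subseteq>
         {x} \<times> L1_space Y \<mu> (endo_module V x) (unif_conv_seminorms V (S_family V \<Theta> \<E> x)) \<and>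
       (\<forall>F G. (x, F) \<in> carrier (stalk Q x) \<and> (x, G) \<in> carrier (stalk Q x) \<longrightarrow>
          (x, F) \<oplus>\<^bsub>stalk Q x\<^esub> (x, G) = (x, \<lambda>t\<in>topspace Y. F t \<oplus>\<^bsub>endo_module V x\<^esub> G t)) \<and>
       (\<forall>c F. (x, F) \<in> carrier (stalk Q x) \<longrightarrow>
          c \<odot>\<^bsub>stalk Q x\<^esub> (x, F) = (x, \<lambda>t\<in>topspace Y. c \<odot>\<^bsub>endo_module V x\<^esub> F t))) \<and>
    sn_index Q = {N. finite N \<and> N \<subseteq> topspace Y \<times> sn_index V \<times> \<Theta>} \<and>
    (\<forall>N\<in>sn_index Q. \<forall>(x, F)\<in>topspace (total Q).
       sn Q N (x, F) = Max (insert 0 ((\<lambda>i. P_seminorm V \<E> x i F) ` N)))"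

definition eval_at ::
    "('x, 'e, 'j) tvs_bundle \<Rightarrow> ('x \<Rightarrow> 'x \<times> ('y \<Rightarrow> 'e \<Rightarrow> 'e)) \<Rightarrow> 'y \<Rightarrow> 'x \<Rightarrow> 'e \<Rightarrow> 'e"
  where "eval_at V F t = (\<lambda>x\<in>topspace (base_space V). snd (F x) t)"

definition bullet ::
    "('x, 'e, 'j) tvs_bundle \<Rightarrow> ('x \<Rightarrow> 'e \<Rightarrow> 'e) \<Rightarrow> ('x \<Rightarrow> 'e) \<Rightarrow> 'x \<Rightarrow> 'e"
  where "bullet V T w = (\<lambda>x\<in>topspace (base_space V). T x (w x))"

definition invariant_theta_structure ::
    "('x, 'e, 'j) tvs_bundle \<Rightarrow> ('x, 'e, 'j, 'y) op_bundle \<Rightarrow> 'y topology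
      \<Rightarrow> ('x \<Rightarrow> 'e set) set \<Rightarrow> ('x \<Rightarrow> 'e) set \<Rightarrow> (('y \<Rightarrow> complex) \<Rightarrow> complex) \<Rightarrow> bool"
  where "invariant_theta_structure V Q Y \<Theta> \<E> \<mu> \<longleftrightarrow>
    theta_structure V Q Y \<Theta> \<E> \<mu> \<and>
    {F \<in> bounded_sections Q (topspace (base_space Q)).
       \<forall>t\<in>topspace Y. bullet V (eval_at V F t) ` E_Theta V \<Theta> \<E> \<subseteq> cont_sections V}
      = cont_sections Q"

definition diamond :: "('x, 'h, 'k) tvs_bundle \<Rightarrow> ('x \<Rightarrow> 'h) set \<Rightarrow> 'x \<Rightarrow> ('x \<Rightarrow> 'h) set"
  where "diamond Q A x = {H \<in> A. \<exists>F\<in>cont_sections Q. H x = F x}"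

definition peq ::
    "('x, 'e, 'j) tvs_bundle \<Rightarrow> 'y topology \<Rightarrow> ('x \<Rightarrow> 'x \<times> ('y \<Rightarrow> 'e \<Rightarrow> 'e)) set
      \<Rightarrow> ('x \<Rightarrow> 'x \<times> ('y \<Rightarrow> 'e \<Rightarrow> 'e)) set"
  where "peq V Y A =
    {F \<in> A. \<forall>t\<in>topspace Y. \<forall>j\<in>sn_index V. \<exists>a>0. \<exists>j1\<in>sn_index V.
       \<forall>z\<in>topspace (base_space V). \<forall>v\<in>carrier (stalk V z).
         sn V j (snd (F z) t v) \<le> a * sn V j1 v}"

end

theory Submission
  imports Defs
begin

text \<open>
  Let \<open>F\<close> be a global continuous section through \<open>H x\<close>. By invariance every \<open>F\<^sub>t \<bullet> w\<close> is a global
  continuous section, so the tubes around it are open neighbourhoods of \<open>(H\<^sub>t \<bullet> w) x = (F\<^sub>t \<bullet> w) x\<close>,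
  and continuity of \<open>H\<^sub>t \<bullet> w\<close> at \<open>x\<close> makes the seminorms of \<open>(H\<^sub>t \<bullet> w) z - (F\<^sub>t \<bullet> w) z\<close> small for
  \<open>z\<close> near \<open>x\<close>. Since the members of \<open>\<Theta>\<close> are single sections, these are exactly the seminorms that
  define the topology of the operator bundle, so \<open>H\<close> inherits the continuity of \<open>F\<close> at \<open>x\<close>.
\<close>

section \<open>Subtraction and seminorms in modules\<close>

text \<open>A \<open>theta_structure\<close> prescribes only addition and scalar multiplication on
  the stalks of the operator bundle, so differences there become computable once they are expressed
  by these two operations. Uniqueness of the additive inverse gives the formula.\<close>

lemma module_minus_eq:
  fixes M :: "(complex, 'a) module"
  assumes "module complex_field M" and "a \<in> carrier M" and "b \<in> carrier M"
  shows "a \<ominus>\<^bsub>M\<^esub> b = a \<oplus>\<^bsub>M\<^esub> ((-1) \<odot>\<^bsub>M\<^esub> b)"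
proof -
  interpret module complex_field M by fact
  have carr: "c \<in> carrier complex_field" for c :: complex
    by (simp add: ring_of_type_algebra_def)
  have "((-1) \<odot>\<^bsub>M\<^esub> b) \<oplus>\<^bsub>M\<^esub> b = ((-1) \<odot>\<^bsub>M\<^esub> b) \<oplus>\<^bsub>M\<^esub> (1 \<odot>\<^bsub>M\<^esub> b)"
    using smult_one[OF assms(3)] by (simp add: ring_of_type_algebra_def)
  also have "\<dots> = ((-1) \<oplus>\<^bsub>complex_field\<^esub> 1) \<odot>\<^bsub>M\<^esub> b"
    using smult_l_distr[OF carr carr assms(3)] by simp
  also have "\<dots> = \<zero>\<^bsub>complex_field\<^esub> \<odot>\<^bsub>M\<^esub> b"
    by (simp add: ring_of_type_algebra_def)
  also have "\<dots> = \<zero>\<^bsub>M\<^esub>"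
    using assms(3) by simp
  finally have "\<ominus>\<^bsub>M\<^esub> b = (-1) \<odot>\<^bsub>M\<^esub> b"
    using M.minus_equality assms(3) smult_closed carr by metis
  then show ?thesis
    by (simp add: a_minus_def)
qed

lemma module_minus_add_minus:
  fixes M :: "(complex, 'a) module"
  assumes "module complex_field M" and "a \<in> carrier M" and "b \<in> carrier M" and "c \<in> carrier M"
  shows "a \<ominus>\<^bsub>M\<^esub> c = (a \<ominus>\<^bsub>M\<^esub> b) \<oplus>\<^bsub>M\<^esub> (b \<ominus>\<^bsub>M\<^esub> c)"
proof -
  interpret module complex_field M by fact
  have "(a \<ominus>\<^bsub>M\<^esub> b) \<oplus>\<^bsub>M\<^esub> (b \<ominus>\<^bsub>M\<^esub> c) = a \<oplus>\<^bsub>M\<^esub> ((\<ominus>\<^bsub>M\<^esub> b \<oplus>\<^bsub>M\<^esub> b) \<oplus>\<^bsub>M\<^esub> \<ominus>\<^bsub>M\<^esub> c)"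
    using assms(2-) by (simp add: a_minus_def M.a_assoc)
  also have "\<dots> = a \<ominus>\<^bsub>M\<^esub> c"
    using assms(2-) by (simp add: a_minus_def M.l_neg)
  finally show ?thesis by simp
qed

lemma seminorm_on_minus_self:
  assumes "module complex_field M" and "seminorm_on M p" and "a \<in> carrier M"
  shows "p (a \<ominus>\<^bsub>M\<^esub> a) = 0"
proof -
  interpret module complex_field M by fact
  \<comment> \<open>\<open>seminorm_on\<close> has no clause for the zero vector; as a multiple by
    the scalar 0, the difference falls under homogeneity.\<close>
  have "a \<ominus>\<^bsub>M\<^esub> a = 0 \<odot>\<^bsub>M\<^esub> a"
    using assms(3) smult_l_null[OF assms(3)] M.r_neg
    by (simp add: a_minus_def ring_of_type_algebra_def)
  then show ?thesis
    using assms(2,3) by (auto simp: seminorm_on_def)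
qed

section \<open>Stalks, tubes and sections of a bundle\<close>

lemma omega_bundleD:
  assumes "omega_bundle V" and "x \<in> topspace (base_space V)"
  shows "module complex_field (stalk V x)"
    and "carrier (stalk V x) = {e \<in> topspace (total V). proj V e = x}"
    and "j \<in> sn_index V \<Longrightarrow> seminorm_on (stalk V x) (sn V j)"
  using assms by (auto simp: omega_bundle_def)

lemma openin_tube:
  assumes "omega_bundle V" and "openin (base_space V) U" and "\<sigma> \<in> cont_sections_on V U"
    and "\<epsilon> > 0" and "j \<in> sn_index V"
  shows "openin (total V) (tube V U \<sigma> \<epsilon> j)"
proof -
  have "tube V U \<sigma> \<epsilon> j \<in> tubes V"
    using assms(2-) by (auto simp: tubes_def)
  moreover have "openin (total V) = arbitrary union_of (\<lambda>T. T \<in> tubes V)"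
    using assms(1) by (simp add: omega_bundle_def)
  ultimately show ?thesis
    by (simp add: arbitrary_union_of_inc)
qed

lemma openin_total_imp_tube:
  assumes "omega_bundle V" and "openin (total V) W" and "e \<in> W"
  obtains U \<sigma> \<epsilon> j where "openin (base_space V) U" "\<sigma> \<in> cont_sections_on V U" "\<epsilon> > 0"
    "j \<in> sn_index V" "e \<in> tube V U \<sigma> \<epsilon> j" "tube V U \<sigma> \<epsilon> j \<subseteq> W"
proof -
  have "(arbitrary union_of (\<lambda>T. T \<in> tubes V)) W"
    using assms(1,2) by (simp add: omega_bundle_def)
  then obtain T where "T \<in> tubes V" "e \<in> T" "T \<subseteq> W"
    using assms(3) by (auto simp: union_of_def)
  then show thesis
    using that by (auto simp: tubes_def)
qed

lemma bounded_sections_carrier: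
  "\<sigma> \<in> bounded_sections V U \<Longrightarrow> z \<in> U \<Longrightarrow> \<sigma> z \<in> carrier (stalk V z)"
  by (auto simp: bounded_sections_def)

lemma cont_sections_on_bounded: "\<sigma> \<in> cont_sections_on V U \<Longrightarrow> \<sigma> \<in> bounded_sections V U"
  by (simp add: cont_sections_on_def)

section \<open>Continuity at a point, measured against a global section\<close>

text \<open>The tube of radius \<epsilon> over the whole base around \<open>F\<close> is open
  because \<open>F\<close> is continuous, and it contains \<open>H x\<close> because the difference
  at \<open>x\<close> is zero. Its preimage under \<open>H\<close> therefore contains a
  neighbourhood of \<open>x\<close>. Applied below to sections of \<open>V\<close>.\<close>

lemma cont_sections_at_imp_near:
  assumes V: "omega_bundle V" and H: "H \<in> cont_sections_at V x" and F: "F \<in> cont_sections V"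
    and eq: "H x = F x" and j: "j \<in> sn_index V" and \<epsilon>: "\<epsilon> > 0"
  shows "\<exists>W. openin (base_space V) W \<and> x \<in> W \<and>
    (\<forall>z\<in>W. sn V j (H z \<ominus>\<^bsub>stalk V z\<^esub> F z) < \<epsilon>)"
proof -
  let ?X = "topspace (base_space V)"
  have cont: "topcontinuous_at (base_space V) (total V) H x" and Hb: "H \<in> bounded_sections V ?X"
    using H by (auto simp: cont_sections_on_at_def)
  have x: "x \<in> ?X"
    using cont by (simp add: topcontinuous_at_def)
  have Hz: "H z \<in> topspace (total V)" "proj V (H z) = z" if "z \<in> ?X" for z
    using bounded_sections_carrier[OF Hb that] omega_bundleD(2)[OF V that] by auto
  have "H x \<in> tube V ?X F \<epsilon> j"
    using seminorm_on_minus_self[OF omega_bundleD(1)[OF V x] omega_bundleD(3)[OF V x j]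
        bounded_sections_carrier[OF Hb x]] Hz[OF x] x \<epsilon>
    by (simp add: tube_def eq)
  moreover have "openin (total V) (tube V ?X F \<epsilon> j)"
    using openin_tube[OF V _ F \<epsilon> j] by simp
  ultimately obtain W where W: "openin (base_space V) W" "x \<in> W" "\<forall>z\<in>W. H z \<in> tube V ?X F \<epsilon> j"
    using cont by (force simp: topcontinuous_at_def)
  have "sn V j (H z \<ominus>\<^bsub>stalk V z\<^esub> F z) < \<epsilon>" if "z \<in> W" for z
  proof -
    have "z \<in> ?X"
      using that openin_subset[OF W(1)] by blast
    then show ?thesis
      using W(3) that by (force simp: tube_def Hz(2))
  qed
  then show ?thesis
    using W by blast
qed

text \<open>Converse criterion, applied below to the operator bundle. A basic neighbourhood of
  \<open>H x\<close> is a tube around an arbitrary local section \<sigma>, not around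
  \<open>F\<close>. Continuity of \<open>F\<close> keeps \<open>F z\<close> in a narrower tube
  around \<sigma>, and the triangle inequality spends the remaining width on the distance from
  \<open>H z\<close> to \<open>F z\<close>.\<close>

lemma cont_sections_atI_near:
  assumes V: "omega_bundle V" and x: "x \<in> topspace (base_space V)"
    and H: "H \<in> bounded_sections V (topspace (base_space V))" and F: "F \<in> cont_sections V"
    and eq: "H x = F x"
    and near: "\<And>j \<epsilon>. j \<in> sn_index V \<Longrightarrow> \<epsilon> > 0 \<Longrightarrow> \<exists>W. openin (base_space V) W \<and> x \<in> W \<and>
      (\<forall>z\<in>W. sn V j (H z \<ominus>\<^bsub>stalk V z\<^esub> F z) < \<epsilon>)"
  shows "H \<in> cont_sections_at V x"
proof -
  let ?X = "topspace (base_space V)"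
  have Hc: "H z \<in> carrier (stalk V z)" "H z \<in> topspace (total V)" "proj V (H z) = z"
    if "z \<in> ?X" for z
    using bounded_sections_carrier[OF H that] omega_bundleD(2)[OF V that] by auto
  have Fc: "F z \<in> carrier (stalk V z)" "F z \<in> topspace (total V)" "proj V (F z) = z"
    if "z \<in> ?X" for z
    using bounded_sections_carrier[OF cont_sections_on_bounded[OF F] that] omega_bundleD(2)[OF V that]
    by auto
  have "\<exists>W. openin (base_space V) W \<and> x \<in> W \<and> (\<forall>z\<in>W. H z \<in> G)"
    if G: "openin (total V) G" "H x \<in> G" for G
  proof -
    obtain U \<sigma> \<epsilon> j where U: "openin (base_space V) U" and \<sigma>: "\<sigma> \<in> cont_sections_on V U"
      and "\<epsilon> > 0" and j: "j \<in> sn_index V" and Hx: "H x \<in> tube V U \<sigma> \<epsilon> j"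
      and sub: "tube V U \<sigma> \<epsilon> j \<subseteq> G"
      by (rule openin_total_imp_tube[OF V G])
    let ?r = "sn V j (F x \<ominus>\<^bsub>stalk V x\<^esub> \<sigma> x)"
    have r: "?r < \<epsilon>" and xU: "x \<in> U"
      using Hx Fc(3)[OF x] by (auto simp: tube_def eq)
    \<comment> \<open>\<delta> splits the radius: \<open>F\<close> stays within \<delta> of
      \<sigma>, leaving \<epsilon> - \<delta> for \<open>H\<close> against \<open>F\<close>. The
      maximum with 0 makes \<delta> positive, as the radius of a tube must be.\<close>
    obtain \<delta> where \<delta>: "?r < \<delta>" "0 < \<delta>" "\<delta> < \<epsilon>"
      using dense[of "max ?r 0" \<epsilon>] r \<open>\<epsilon> > 0\<close> by auto
    define W1 where "W1 = {z \<in> ?X. F z \<in> tube V U \<sigma> \<delta> j}"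
    have W1: "openin (base_space V) W1"
      using openin_continuous_map_preimage[OF _ openin_tube[OF V U \<sigma> \<delta>(2) j]] F
      by (auto simp: W1_def cont_sections_on_def)
    have xW1: "x \<in> W1"
      using \<delta>(1) x xU Fc[OF x] by (simp add: W1_def tube_def)
    obtain W2 where W2: "openin (base_space V) W2" "x \<in> W2"
      "\<And>z. z \<in> W2 \<Longrightarrow> sn V j (H z \<ominus>\<^bsub>stalk V z\<^esub> F z) < \<epsilon> - \<delta>"
      using near[OF j, of "\<epsilon> - \<delta>"] \<delta>(3) by auto
    have "H z \<in> G" if z: "z \<in> W1 \<inter> W2" for z
    proof -
      have zX: "z \<in> ?X" and Fz: "F z \<in> tube V U \<sigma> \<delta> j"
        using z by (auto simp: W1_def)
      have zU: "z \<in> U" and F\<sigma>: "sn V j (F z \<ominus>\<^bsub>stalk V z\<^esub> \<sigma> z) < \<delta>"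
        using Fz Fc(3)[OF zX] by (auto simp: tube_def)
      have \<sigma>c: "\<sigma> z \<in> carrier (stalk V z)"
        using bounded_sections_carrier[OF cont_sections_on_bounded[OF \<sigma>] zU] .
      interpret module complex_field "stalk V z"
        by (rule omega_bundleD(1)[OF V zX])
      have "sn V j (H z \<ominus>\<^bsub>stalk V z\<^esub> \<sigma> z) =
          sn V j ((H z \<ominus>\<^bsub>stalk V z\<^esub> F z) \<oplus>\<^bsub>stalk V z\<^esub> (F z \<ominus>\<^bsub>stalk V z\<^esub> \<sigma> z))"
        using module_minus_add_minus[OF omega_bundleD(1)[OF V zX] Hc(1)[OF zX] Fc(1)[OF zX] \<sigma>c]
        by simp
      also have "\<dots> \<le> sn V j (H z \<ominus>\<^bsub>stalk V z\<^esub> F z) + sn V j (F z \<ominus>\<^bsub>stalk V z\<^esub> \<sigma> z)"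
        using omega_bundleD(3)[OF V zX j] M.minus_closed Hc(1)[OF zX] Fc(1)[OF zX] \<sigma>c
        by (auto simp: seminorm_on_def)
      also have "\<dots> < \<epsilon>"
        using F\<sigma> W2(3)[of z] z by auto
      finally have "H z \<in> tube V U \<sigma> \<epsilon> j"
        using Hc[OF zX] zU by (simp add: tube_def)
      then show ?thesis
        using sub by blast
    qed
    then show ?thesis
      using W1 xW1 W2(1,2) by (intro exI[of _ "W1 \<inter> W2"]) auto
  qed
  then have "topcontinuous_at (base_space V) (total V) H x"
    using x Hc(2) by (auto simp: topcontinuous_at_def)
  then show ?thesis
    using H by (simp add: cont_sections_on_at_def)
qed

section \<open>Pointwise operations and the singleton family\<close>

lemma theta_structure_carrierD:
  assumes "theta_structure V Q Y \<Theta> \<E> \<mu>" and "z \<in> topspace (base_space V)"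
    and "h \<in> carrier (stalk Q z)"
  shows "fst h = z" and "t \<in> topspace Y \<Longrightarrow> e \<in> carrier (stalk V z) \<Longrightarrow> snd h t e \<in> carrier (stalk V z)"
proof -
  have h: "h \<in> {z} \<times> L1_space Y \<mu> (endo_module V z) (unif_conv_seminorms V (S_family V \<Theta> \<E> z))"
    using assms by (auto simp: theta_structure_def)
  then show "fst h = z"
    by auto
  assume "t \<in> topspace Y" "e \<in> carrier (stalk V z)"
  moreover from this have "snd h t \<in> carrier (endo_module V z)"
    using h by (auto simp: L1_space_def)
  ultimately show "snd h t e \<in> carrier (stalk V z)"
    by (auto simp: endo_module_def Let_def linear_maps_def)
qed

text \<open>Differences in the operator bundle are thereby reduced to differences in
  \<open>V\<close>, where the seminorms \<open>sn V j\<close> are evaluated.\<close>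

lemma theta_structure_minus_apply:
  assumes Q: "theta_structure V Q Y \<Theta> \<E> \<mu>" and z: "z \<in> topspace (base_space V)"
    and f: "f \<in> carrier (stalk Q z)" and g: "g \<in> carrier (stalk Q z)"
    and t: "t \<in> topspace Y" and e: "e \<in> carrier (stalk V z)"
  shows "snd (f \<ominus>\<^bsub>stalk Q z\<^esub> g) t e = snd f t e \<ominus>\<^bsub>stalk V z\<^esub> snd g t e"
proof -
  have V: "omega_bundle V" and "omega_bundle Q" "base_space Q = base_space V"
    using Q by (auto simp: theta_structure_def)
  then have mQ: "module complex_field (stalk Q z)"
    using omega_bundleD(1) z by metis
  then interpret module complex_field "stalk Q z" .
  obtain F G where fg: "f = (z, F)" "g = (z, G)"
    using theta_structure_carrierD(1)[OF Q z] f g by (metis prod.collapse)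
  have smult: "(-1) \<odot>\<^bsub>stalk Q z\<^esub> g = (z, \<lambda>t\<in>topspace Y. (-1) \<odot>\<^bsub>endo_module V z\<^esub> G t)"
    using Q z g by (simp add: theta_structure_def fg)
  \<comment> \<open>The pointwise formula for addition holds only for members of the stalk, so the
    multiple by -1 has to be placed in it first.\<close>
  have "(-1) \<odot>\<^bsub>stalk Q z\<^esub> g \<in> carrier (stalk Q z)"
    using g by (intro smult_closed) (simp_all add: ring_of_type_algebra_def)
  then have "f \<ominus>\<^bsub>stalk Q z\<^esub> g = (z, \<lambda>t\<in>topspace Y. F t \<oplus>\<^bsub>endo_module V z\<^esub>
      (\<lambda>t\<in>topspace Y. (-1) \<odot>\<^bsub>endo_module V z\<^esub> G t) t)"
    using Q z f unfolding module_minus_eq[OF mQ f g] smult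
    by (simp add: theta_structure_def fg)
  then have "snd (f \<ominus>\<^bsub>stalk Q z\<^esub> g) t e = F t e \<oplus>\<^bsub>stalk V z\<^esub> ((-1) \<odot>\<^bsub>stalk V z\<^esub> G t e)"
    using t e by (simp add: endo_module_def Let_def)
  also have "\<dots> = F t e \<ominus>\<^bsub>stalk V z\<^esub> G t e"
    using module_minus_eq[OF omega_bundleD(1)[OF V z]] theta_structure_carrierD(2)[OF Q z _ t e] f g
    by (metis fg snd_conv)
  finally show ?thesis
    by (simp add: fg)
qed

text \<open>Members of \<E> are extensional, so agreeing with \<open>w\<close> on the base space
  already means being equal to \<open>w\<close>. Hence the supremum in \<open>P_seminorm\<close>
  runs over a single section.\<close>

lemma D_set_singleton:
  assumes "\<E> \<subseteq> cont_sections V" and "w \<in> \<E>"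
  shows "D_set V (\<lambda>x\<in>topspace (base_space V). {w x}) \<E> = {w}"
proof -
  have ext: "v \<in> extensional (topspace (base_space V))" if "v \<in> \<E>" for v
    using assms(1) that by (auto simp: cont_sections_on_def bounded_sections_def PiE_def)
  have "v = w" if "v \<in> \<E>" "v \<in> (\<Pi>\<^sub>E x\<in>topspace (base_space V). {w x})" for v
    using that ext[OF assms(2)] by (intro extensionalityI[of v _ w]) (auto simp: PiE_def Pi_def)
  moreover have "(\<Pi>\<^sub>E x\<in>topspace (base_space V). (\<lambda>x\<in>topspace (base_space V). {w x}) x)
      = (\<Pi>\<^sub>E x\<in>topspace (base_space V). {w x})"
    by (rule PiE_cong) simp
  moreover have "w \<in> (\<Pi>\<^sub>E x\<in>topspace (base_space V). {w x})"
    using ext[OF assms(2)] by (auto simp: PiE_def)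
  ultimately show ?thesis
    using assms(2) by (auto simp: D_set_def)
qed

section \<open>Transfer of continuity to the operator bundle\<close>

theorem lemma3p3p15:
  fixes V :: "('x, 'e, 'j) tvs_bundle"
    and Q :: "('x, 'e, 'j, 'y) op_bundle"
    and Y :: "'y topology"
    and \<mu> :: "('y \<Rightarrow> complex) \<Rightarrow> complex"
    and \<E> :: "('x \<Rightarrow> 'e) set"
    and \<Theta> :: "('x \<Rightarrow> 'e set) set"
  assumes "locally_compact_space Y" and "Hausdorff_space Y"
    and "radon_measure Y \<mu>"
    and "\<Theta> = {(\<lambda>x\<in>topspace (base_space V). {w x}) | w. w \<in> \<E>}"
    and "invariant_theta_structure V Q Y \<Theta> \<E> \<mu>"
  shows "\<forall>x\<in>topspace (base_space V).
    {H \<in> peq V Y (diamond Q (bounded_sections Q (topspace (base_space Q))) x).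
       \<forall>t\<in>topspace Y. bullet V (eval_at V H t) ` E_Theta V \<Theta> \<E> \<subseteq> cont_sections_at V x}
      \<subseteq> diamond Q (cont_sections_at Q x) x"
proof (intro ballI subsetI)
  fix x H
  let ?X = "topspace (base_space V)"
  let ?B = "\<lambda>w. \<lambda>x\<in>?X. {w x}"
  assume x: "x \<in> ?X"
    and "H \<in> {H \<in> peq V Y (diamond Q (bounded_sections Q (topspace (base_space Q))) x).
       \<forall>t\<in>topspace Y. bullet V (eval_at V H t) ` E_Theta V \<Theta> \<E> \<subseteq> cont_sections_at V x}"
  then have H: "H \<in> bounded_sections Q (topspace (base_space Q))"
    and "\<exists>F\<in>cont_sections Q. H x = F x"
    and Hcont: "\<And>t w. t \<in> topspace Y \<Longrightarrow> w \<in> E_Theta V \<Theta> \<E> \<Longrightarrow>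
      bullet V (eval_at V H t) w \<in> cont_sections_at V x"
    by (simp_all add: peq_def diamond_def image_subset_iff)
  then obtain F where F: "F \<in> cont_sections Q" and eq: "H x = F x"
    by blast
  have st: "theta_structure V Q Y \<Theta> \<E> \<mu>"
    and inv: "{F \<in> bounded_sections Q (topspace (base_space Q)).
       \<forall>t\<in>topspace Y. bullet V (eval_at V F t) ` E_Theta V \<Theta> \<E> \<subseteq> cont_sections V}
      = cont_sections Q"
    using assms(5) unfolding invariant_theta_structure_def by (rule conjunct1, rule conjunct2)
  \<comment> \<open>Invariance is read from right to left: as a continuous section, \<open>F\<close>
    satisfies the condition that defines the left-hand set.\<close>
  have Fcont: "bullet V (eval_at V F t) w \<in> cont_sections V"
    if "t \<in> topspace Y" "w \<in> E_Theta V \<Theta> \<E>" for t w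
    using F that unfolding inv[symmetric] by blast
  have V: "omega_bundle V" and Q: "omega_bundle Q" and base: "base_space Q = base_space V"
    and \<E>: "\<E> \<subseteq> cont_sections V"
    and index: "sn_index Q = {N. finite N \<and> N \<subseteq> topspace Y \<times> sn_index V \<times> \<Theta>}"
    and snQ: "\<forall>N\<in>sn_index Q. \<forall>(z, f)\<in>topspace (total Q).
       sn Q N (z, f) = Max (insert 0 ((\<lambda>i. P_seminorm V \<E> z i f) ` N))"
    using st unfolding theta_structure_def by - (elim conjE, assumption)+
  have Hc: "H z \<in> carrier (stalk Q z)" and Fc: "F z \<in> carrier (stalk Q z)" if "z \<in> ?X" for z
    using bounded_sections_carrier[OF H] bounded_sections_carrier[OF cont_sections_on_bounded[OF F]]
      that base by auto
  \<comment> \<open>First a single index \<open>i\<close>; the finite sets that index the seminorms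
    of \<open>Q\<close> are handled afterwards by intersecting neighbourhoods.\<close>
  have P_near: "\<exists>W. openin (base_space V) W \<and> x \<in> W \<and>
      (\<forall>z\<in>W. P_seminorm V \<E> z i (snd (H z \<ominus>\<^bsub>stalk Q z\<^esub> F z)) < \<epsilon>)"
    if i: "i \<in> topspace Y \<times> sn_index V \<times> \<Theta>" and "\<epsilon> > 0" for i and \<epsilon> :: real
  proof -
    obtain t j w where i: "i = (t, j, ?B w)" and t: "t \<in> topspace Y" and j: "j \<in> sn_index V"
      and w: "w \<in> \<E>"
      using i by (auto simp: assms(4))
    note D = D_set_singleton[OF \<E> w]
    have wE: "w \<in> E_Theta V \<Theta> \<E>"
      using w D by (auto simp: E_Theta_def assms(4))
    have "bullet V (eval_at V H t) w x = bullet V (eval_at V F t) w x"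
      using x eq by (simp add: bullet_def eval_at_def)
    from cont_sections_at_imp_near[OF V Hcont[OF t wE] Fcont[OF t wE] this j \<open>\<epsilon> > 0\<close>]
    obtain W where W: "openin (base_space V) W" "x \<in> W"
      "\<And>z. z \<in> W \<Longrightarrow> sn V j (bullet V (eval_at V H t) w z \<ominus>\<^bsub>stalk V z\<^esub>
          bullet V (eval_at V F t) w z) < \<epsilon>"
      by blast
    have "P_seminorm V \<E> z i (snd (H z \<ominus>\<^bsub>stalk Q z\<^esub> F z)) < \<epsilon>" if "z \<in> W" for z
    proof -
      have z: "z \<in> ?X"
        using that W(1) openin_subset by blast
      have "w z \<in> carrier (stalk V z)"
        by (rule bounded_sections_carrier[OF cont_sections_on_bounded[OF subsetD[OF \<E> w]] z])
      \<comment> \<open>With the supremum reduced to \<open>w\<close> alone, the seminorm of the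
        operator difference is exactly the quantity bounded on \<open>W\<close>.\<close>
      from theta_structure_minus_apply[OF st z Hc[OF z] Fc[OF z] t this]
      show ?thesis
        using W(3)[OF that] z
        by (simp add: P_seminorm_def i D bullet_def eval_at_def)
    qed
    then show ?thesis
      using W by blast
  qed
  have "H \<in> cont_sections_at Q x"
  proof (rule cont_sections_atI_near[OF Q _ H F eq])
    show "x \<in> topspace (base_space Q)"
      using x base by simp
  next
    fix N and \<epsilon> :: real
    assume N: "N \<in> sn_index Q" and \<epsilon>: "\<epsilon> > 0"
    then have fin: "finite N" and sub: "N \<subseteq> topspace Y \<times> sn_index V \<times> \<Theta>"
      by (auto simp: index)
    have "\<forall>i\<in>N. \<exists>W. openin (base_space V) W \<and> x \<in> W \<and>
      (\<forall>z\<in>W. P_seminorm V \<E> z i (snd (H z \<ominus>\<^bsub>stalk Q z\<^esub> F z)) < \<epsilon>)"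
      using P_near sub \<epsilon> by blast
    then obtain W where W: "\<And>i. i \<in> N \<Longrightarrow> openin (base_space V) (W i)" "\<And>i. i \<in> N \<Longrightarrow> x \<in> W i"
      "\<And>i z. i \<in> N \<Longrightarrow> z \<in> W i \<Longrightarrow>
        P_seminorm V \<E> z i (snd (H z \<ominus>\<^bsub>stalk Q z\<^esub> F z)) < \<epsilon>"
      by metis
    \<comment> \<open>Finiteness of \<open>N\<close> makes the intersection open. Intersecting with
      the base space also covers empty \<open>N\<close>, where \<open>W0\<close> is the whole
      base.\<close>
    define W0 where "W0 = (\<Inter>i\<in>N. W i) \<inter> ?X"
    have "openin (base_space V) W0"
      unfolding W0_def using fin W(1) by (rule openin_INT)
    moreover have "x \<in> W0"
      using x W(2) by (auto simp: W0_def)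
    moreover have "sn Q N (H z \<ominus>\<^bsub>stalk Q z\<^esub> F z) < \<epsilon>" if z: "z \<in> W0" for z
    proof -
      let ?d = "H z \<ominus>\<^bsub>stalk Q z\<^esub> F z"
      have zX: "z \<in> ?X"
        using z by (simp add: W0_def)
      interpret module complex_field "stalk Q z"
        using omega_bundleD(1)[OF Q] zX base by simp
      have d: "?d \<in> carrier (stalk Q z)"
        using Hc[OF zX] Fc[OF zX] by simp
      then have "?d \<in> topspace (total Q)"
        using omega_bundleD(2)[OF Q, of z] zX base by auto
      \<comment> \<open>The formula for \<open>sn Q N\<close> is stated for pairs tagged with the
        base point, so the difference is first put into that form.\<close>
      moreover obtain f where "?d = (z, f)"
        using theta_structure_carrierD(1)[OF st zX d] by (cases ?d) auto
      ultimately have "sn Q N ?d = Max (insert 0 ((\<lambda>i. P_seminorm V \<E> z i (snd ?d)) ` N))"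
        using bspec[OF bspec[OF snQ N], of ?d] by simp
      \<comment> \<open>A maximum over a finite set is below \<epsilon> as soon as each entry is;
        the inserted default 0 is, since \<epsilon> is positive.\<close>
      also have "\<dots> < \<epsilon>"
        using fin \<epsilon> W(3) z by (auto simp: W0_def)
      finally show ?thesis .
    qed
    ultimately show "\<exists>W. openin (base_space Q) W \<and> x \<in> W \<and>
        (\<forall>z\<in>W. sn Q N (H z \<ominus>\<^bsub>stalk Q z\<^esub> F z) < \<epsilon>)"
      using base by auto
  qed
  then show "H \<in> diamond Q (cont_sections_at Q x) x"
    using F eq by (auto simp: diamond_def)
qed

end
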